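(* Let $\Gamma=(V,E)$ be a weighted strongly-connected digraph on $n$ vertices and let $\mathbf{G}$ be its combinatorial Green's function. Then for all $u,v\in V$, $$\mathbf{G}(u,v)=\frac{1}{n\sum_{w\in V} \tau_w^2}\Big(\sum_{\substack{T_1\cup T_2\in \mathbb{F}^*_2\\ u\in T_1,\ r(T_1)=v}}|T_2|\,\tau_{r(T_2)}\,\omega(T_1\cup T_2)-\sum_{\substack{T_1\cup T_2\in \mathbb{F}^*_2\\ u\in T_2,\ r(T_1)=v}}|T_1|\,\tau_{r(T_2)}\,\omega(T_1\cup T_2)\Big).$$
   Context: A weighted digraph $\Gamma=(V,E)$ is finite, has no loops, and has at most one edge $(u,v)$ for each ordered pair of distinct vertices; each edge $e=(u,v)\in E$ has a weight $\omega(e)=\omega(u,v)>0$, and $\omega(u,v)=0$ if $(u,v)\notin E$. The adjacency matrix is $A(u,v)=\omega(u,v)$, the (out-)degree is $d_u=\sum_v\omega(u,v)$, $D=\mathrm{Diag}[d_u]$, and the combinatorial Laplacian is $L=D-A$. The combinatorial Green's function $\mathbf{G}$ is the Moore–Penrose pseudoinverse of $L$; matrices are indexed by $V$. A rooted $k$-forest is a digraph whose underlying undirected graph is a forest with $k$ connected components (no cycles; in particular it does not contain both $(u,v)$ and $(v,u)$) and such that each weakly-connected component has a vertex, its root, to which every vertex of that component has a unique directed path. A subdigraph of $\Gamma$ is spanning if it contains all vertices of $\Gamma$. $\mathbb{F}^*_k$ denotes the set of spanning rooted $k$-forests of $\Gamma$. An element of $\mathbb{F}^*_2$ is written $T_1\cup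 T_2$, where $T_1,T_2$ are its two components; $r(T_i)$ is the root of $T_i$ and $|T_i|$ its number of vertices. The order of $T_1$ and $T_2$ is irrelevant: a sum ranges over forests, each counted once, with the components named so that the condition under the sum holds (here $T_1$ is the component with root $v$). The weight of a forest is $\omega(F)=\prod_{e\in E(F)}\omega(e)$, and $\tau_w=\sum_{T\in\mathbb{F}^*_1,\ r(T)=w}\omega(T)$ is the total weight of the rooted spanning trees with root $w$. *)

theory Defs
  imports "Graph_Theory.Digraph_Component" "HOL-Analysis.Analysis"
begin

section \<open>The Moore--Penrose pseudoinverse\<close>

definition is_pseudoinverse :: "real ^ 'n ^ 'm \<Rightarrow> real ^ 'm ^ 'n \<Rightarrow> bool" where
  "is_pseudoinverse M X \<longleftrightarrow>
     M ** X ** M = M \<and> X ** M ** X = X \<and>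
     transpose (M ** X) = M ** X \<and> transpose (X ** M) = X ** M"

definition pseudoinverse :: "real ^ 'n ^ 'm \<Rightarrow> real ^ 'm ^ 'n" where
  "pseudoinverse M = (THE X. is_pseudoinverse M X)"

lemma is_pseudoinverse_unique:
  fixes M :: "real ^ 'n ^ 'm" and X Y :: "real ^ 'm ^ 'n"
  assumes X: "is_pseudoinverse M X" and Y: "is_pseudoinverse M Y"
  shows "X = Y"
proof -
  have left: "M ** X = M ** Y"
  proof -
    have "M ** X = (M ** Y) ** (M ** X)"
      using Y by (metis is_pseudoinverse_def matrix_mul_assoc)
    also have "\<dots> = transpose ((M ** X) ** (M ** Y))"
      using X Y by (simp add: is_pseudoinverse_def matrix_transpose_mul)
    also have "\<dots> = transpose (M ** Y)"
      using X by (metis is_pseudoinverse_def matrix_mul_assoc)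
    finally show ?thesis using Y by (simp add: is_pseudoinverse_def)
  qed
  have right: "X ** M = Y ** M"
  proof -
    have "X ** M = (X ** M) ** (Y ** M)"
      using Y by (metis is_pseudoinverse_def matrix_mul_assoc)
    also have "\<dots> = transpose ((Y ** M) ** (X ** M))"
      using X Y by (simp add: is_pseudoinverse_def matrix_transpose_mul)
    also have "\<dots> = transpose (Y ** M)"
      using X by (metis is_pseudoinverse_def matrix_mul_assoc)
    finally show ?thesis using Y by (simp add: is_pseudoinverse_def)
  qed
  have "X = X ** (M ** X)"
    using X by (simp add: is_pseudoinverse_def matrix_mul_assoc)
  also have "\<dots> = Y ** M ** Y"
    by (simp add: left right matrix_mul_assoc)
  finally show ?thesis using Y by (simp add: is_pseudoinverse_def)
qed

lemma pseudoinverse_eqI: "is_pseudoinverse M X \<Longrightarrow> pseudoinverse M = X"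
  unfolding pseudoinverse_def by (blast intro: is_pseudoinverse_unique)


section \<open>Weighted digraphs and their Laplacians\<close>

text \<open>The vertex set is the whole of a finite type, so that matrices indexed by the
  vertices are of the form \<^typ>\<open>real ^ 'v ^ 'v\<close>.\<close>

locale weighted_digraph = pair_digraph \<Gamma>
  for \<Gamma> :: "'v::finite pair_pre_digraph" +
  fixes \<omega> :: "'v \<times> 'v \<Rightarrow> real"
  assumes pverts_UNIV: "pverts \<Gamma> = UNIV"
    and weight_pos: "e \<in> parcs \<Gamma> \<Longrightarrow> \<omega> e > 0"
    and weight_zero: "e \<notin> parcs \<Gamma> \<Longrightarrow> \<omega> e = 0"

definition adjacency :: "('v::finite \<times> 'v \<Rightarrow> real) \<Rightarrow> real ^ 'v ^ 'v" where
  "adjacency \<omega> = (\<chi> u v. \<omega> (u, v))"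

definition degree_out :: "('v::finite \<times> 'v \<Rightarrow> real) \<Rightarrow> 'v \<Rightarrow> real" where
  "degree_out \<omega> u = (\<Sum>v\<in>UNIV. \<omega> (u, v))"

definition degree_matrix :: "('v::finite \<times> 'v \<Rightarrow> real) \<Rightarrow> real ^ 'v ^ 'v" where
  "degree_matrix \<omega> = (\<chi> u v. if u = v then degree_out \<omega> u else 0)"

definition laplacian :: "('v::finite \<times> 'v \<Rightarrow> real) \<Rightarrow> real ^ 'v ^ 'v" where
  "laplacian \<omega> = degree_matrix \<omega> - adjacency \<omega>"

definition green :: "('v::finite \<times> 'v \<Rightarrow> real) \<Rightarrow> real ^ 'v ^ 'v" where
  "green \<omega> = pseudoinverse (laplacian \<omega>)"


section \<open>Rooted forests\<close>

definition is_root :: "'v pair_pre_digraph \<Rightarrow> 'v \<Rightarrow> bool" where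
  "is_root T r \<longleftrightarrow>
     r \<in> pverts T \<and> (\<forall>w\<in>pverts T. \<exists>!p. pre_digraph.apath (with_proj T) w p r)"

definition root_of :: "'v pair_pre_digraph \<Rightarrow> 'v" where
  "root_of T = (THE r. is_root T r)"

text \<open>The weakly connected components, as induced subdigraphs.\<close>

definition weak_components :: "'v pair_pre_digraph \<Rightarrow> 'v pair_pre_digraph set" where
  "weak_components F =
     (\<lambda>S. \<lparr>pverts = S, parcs = parcs F \<inter> S \<times> S\<rparr>) `
       pre_digraph.sccs_verts (with_proj (mk_symmetric (with_proj F)))"

text \<open>The underlying undirected graph is represented by the symmetric digraph
  \<^const>\<open>mk_symmetric\<close>. There, going back and forth along one edge is a
  \<^const>\<open>pre_digraph.cycle\<close> of length 2, so the undirected cycles are those of length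
  at least 3. A pair of opposite arcs, which \<^const>\<open>mk_symmetric\<close> merges into one edge,
  is excluded separately.\<close>

definition rooted_forest :: "nat \<Rightarrow> 'v pair_pre_digraph \<Rightarrow> bool" where
  "rooted_forest k F \<longleftrightarrow>
     pair_digraph F \<and>
     (\<forall>u v. (u, v) \<in> parcs F \<longrightarrow> (v, u) \<notin> parcs F) \<and>
     \<not> (\<exists>p. pre_digraph.cycle (with_proj (mk_symmetric (with_proj F))) p \<and> 3 \<le> length p) \<and>
     card (weak_components F) = k \<and>
     (\<forall>T\<in>weak_components F. \<exists>r. is_root T r)"

definition spanning_rooted_forests ::
    "'v pair_pre_digraph \<Rightarrow> nat \<Rightarrow> 'v pair_pre_digraph set" where
  "spanning_rooted_forests \<Gamma> k =
     {F. spanning (with_proj F) (with_proj \<Gamma>) \<and> rooted_forest k F}"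

definition weight :: "('v \<times> 'v \<Rightarrow> real) \<Rightarrow> 'v pair_pre_digraph \<Rightarrow> real" where
  "weight \<omega> F = (\<Prod>e\<in>parcs F. \<omega> e)"

definition tree_weight ::
    "'v pair_pre_digraph \<Rightarrow> ('v \<times> 'v \<Rightarrow> real) \<Rightarrow> 'v \<Rightarrow> real" where
  "tree_weight \<Gamma> \<omega> w =
     (\<Sum>T\<in>{T \<in> spanning_rooted_forests \<Gamma> 1. root_of T = w}. weight \<omega> T)"

text \<open>The spanning rooted 2-forests with their components named in either order. Each
  forest occurs twice here, but prescribing the root of \<open>T1\<close> leaves at most one of the
  two namings, because distinct components have distinct roots.\<close>

definition split_2_forests ::
    "'v pair_pre_digraph
      \<Rightarrow> ('v pair_pre_digraph \<times> 'v pair_pre_digraph \<times> 'v pair_pre_digraph) set" where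
  "split_2_forests \<Gamma> =
     {(F, T1, T2). F \<in> spanning_rooted_forests \<Gamma> 2 \<and> weak_components F = {T1, T2}}"

end

theory Submission
  imports Defs
begin

text \<open>Write \<open>L\<close> for the Laplacian, \<open>\<tau>\<close> for the vector of tree weights and, for two distinct
  vertices \<open>v\<close> and \<open>w\<close>, let \<open>h\<^sub>v\<^sub>w(u)\<close> be the total weight of the spanning forests with roots
  \<open>v\<close> and \<open>w\<close> in which \<open>u\<close> lies in the tree of \<open>v\<close>. Everything follows from the identity
  \<open>L h\<^sub>v\<^sub>w = \<tau>\<^sub>w e\<^sub>v - \<tau>\<^sub>v e\<^sub>w\<close> (lemma \<open>hitting_laplacian\<close>).

  The identity is combinatorial. The number \<open>(L h\<^sub>v\<^sub>w)(u)\<close> is the sum of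
  \<open>\<omega>(u,x) (h\<^sub>v\<^sub>w(u) - h\<^sub>v\<^sub>w(x))\<close> over \<open>x\<close>, so only forests that separate \<open>u\<close> from \<open>x\<close> contribute.
  If \<open>u\<close> is not a root, then replacing the arc that leaves \<open>u\<close> by \<open>(u,x)\<close> moves \<open>u\<close> to the other
  tree; this exchanges positive and negative contributions and leaves their weight unchanged, hence
  \<open>(L h\<^sub>v\<^sub>w)(u) = 0\<close>. If \<open>u\<close> is the root \<open>v\<close>, then adding \<open>(v,x)\<close> to the forest hangs the tree of
  \<open>v\<close> below \<open>w\<close> and produces every spanning tree with root \<open>w\<close> exactly once. The root \<open>w\<close> is
  symmetric.

  The rest is linear algebra. As the rows of \<open>L\<close> sum to zero, \<open>L\<close> is singular and has a left null
  vector \<open>s \<noteq> 0\<close>; pairing it with the identity gives \<open>s\<^sub>v \<tau>\<^sub>w = s\<^sub>w \<tau>\<^sub>v\<close>, so \<open>\<tau>\<close>, which is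
  positive by strong connectivity, is itself a left null vector. Let \<open>X(u,v)\<close> be
  \<open>1/|\<tau>|\<^sup>2\<close> times the sum of \<open>\<tau>\<^sub>w (h\<^sub>v\<^sub>w(u) - m\<^sub>v\<^sub>w)\<close> over all \<open>w \<noteq> v\<close>, where \<open>m\<^sub>v\<^sub>w\<close> is the mean of
  \<open>h\<^sub>v\<^sub>w\<close> over the vertices. The identity gives
  \<open>L X = I - \<tau> \<tau>\<^sup>T/|\<tau>|\<^sup>2\<close>, and the columns of \<open>X\<close> sum to zero. Since the kernel of \<open>L\<close>
  consists of the constant vectors, it follows that \<open>X L = I - J/n\<close>, where \<open>J\<close> is the all-ones
  matrix, and \<open>X\<close> satisfies the four Penrose conditions (lemma \<open>green_hitting\<close>). Finally,
  \<open>n h\<^sub>v\<^sub>w(u) - n m\<^sub>v\<^sub>w\<close> sums, over the forests with roots \<open>v\<close> and \<open>w\<close>, the weight times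
  \<open>n - |T\<^sub>1| = |T\<^sub>2|\<close> if \<open>u\<close> is in the tree \<open>T\<^sub>1\<close> of \<open>v\<close>, and times \<open>- |T\<^sub>1|\<close> otherwise, which is
  the claimed formula.

  All of this is carried out for forests represented by self-maps of the vertex set: a map sends a
  root to itself and any other vertex to the head of its only outgoing arc. In this form moving an
  arc is a function update. A separate part shows that these maps correspond to the spanning rooted
  forests of the digraph, together with their components and roots.\<close>

section \<open>Self-maps all of whose orbits reach a fixed point\<close>

definition settles :: "('v \<Rightarrow> 'v) \<Rightarrow> 'v \<Rightarrow> bool" where
  "settles f x \<longleftrightarrow> (\<exists>k. f ((f ^^ k) x) = (f ^^ k) x)"

text \<open>The number of steps to the root. It is a proper value only where the orbit settles.\<close>

definition depth :: "('v \<Rightarrow> 'v) \<Rightarrow> 'v \<Rightarrow> nat" where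
  "depth f x = (LEAST k. f ((f ^^ k) x) = (f ^^ k) x)"

definition sink :: "('v \<Rightarrow> 'v) \<Rightarrow> 'v \<Rightarrow> 'v" where
  "sink f x = (f ^^ depth f x) x"

definition rooted_map :: "('v \<Rightarrow> 'v) \<Rightarrow> bool" where
  "rooted_map f \<longleftrightarrow> (\<forall>x. settles f x)"

lemma settles_fixed: "f x = x \<Longrightarrow> settles f x"
  unfolding settles_def by (intro exI[of _ 0]) simp

lemma settles_step: "settles f (f x) \<longleftrightarrow> settles f x"
proof
  assume "settles f (f x)"
  then obtain k where "f ((f ^^ k) (f x)) = (f ^^ k) (f x)"
    by (auto simp: settles_def)
  then have "f ((f ^^ Suc k) x) = (f ^^ Suc k) x"
    by (simp add: funpow_swap1)
  then show "settles f x"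
    unfolding settles_def by blast
next
  assume "settles f x"
  then obtain k where "f ((f ^^ k) x) = (f ^^ k) x"
    by (auto simp: settles_def)
  then have "f ((f ^^ k) (f x)) = (f ^^ k) (f x)"
    by (metis funpow_swap1)
  then show "settles f (f x)"
    unfolding settles_def by blast
qed

lemma depth_fixed: "f x = x \<Longrightarrow> depth f x = 0"
  unfolding depth_def by (rule Least_equality) auto

lemma depth_step:
  assumes "settles f x" "f x \<noteq> x"
  shows "depth f x = Suc (depth f (f x))"
proof -
  obtain k where "f ((f ^^ k) x) = (f ^^ k) x"
    using assms by (auto simp: settles_def)
  then have "depth f x = Suc (LEAST m. f ((f ^^ Suc m) x) = (f ^^ Suc m) x)"
    unfolding depth_def by (rule Least_Suc) (use assms in simp)
  then show ?thesis
    by (simp add: depth_def funpow_swap1)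
qed

lemma depth_step_le:
  assumes "settles f x"
  shows "depth f (f x) \<le> depth f x"
proof (cases "f x = x")
  case False
  show ?thesis
    using depth_step[OF assms False] by linarith
qed simp

lemma sink_fixed: "f x = x \<Longrightarrow> sink f x = x"
  by (simp add: sink_def depth_fixed)

lemma sink_step: "settles f x \<Longrightarrow> sink f (f x) = sink f x"
  by (cases "f x = x") (simp_all add: sink_def depth_step funpow_swap1)

lemma fixed_sink: "settles f x \<Longrightarrow> f (sink f x) = sink f x"
  unfolding settles_def sink_def depth_def by (rule LeastI_ex)

lemma settles_induct [consumes 1, case_names fixed step]:
  assumes "settles f x"
    and "\<And>x. f x = x \<Longrightarrow> P x"
    and "\<And>x. f x \<noteq> x \<Longrightarrow> P (f x) \<Longrightarrow> P x"
  shows "P x"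
  using assms(1)
proof (induction "depth f x" arbitrary: x)
  case 0
  then show ?case
    using assms(2) depth_step by fastforce
next
  case (Suc k)
  then show ?case
    using assms(2,3) by (metis depth_step nat.inject settles_step)
qed

text \<open>If the orbit of \<open>z\<close> avoids \<open>u\<close>, then it never uses the arc at \<open>u\<close>, so redirecting that arc leaves
  the orbit and its root alone.\<close>

lemma funpow_upd_unvisited:
  assumes "\<forall>k. (f ^^ k) z \<noteq> u"
  shows "(f(u := x) ^^ k) z = (f ^^ k) z"
  using assms by (induction k) auto

lemma unvisited_upd:
  assumes "\<forall>k. (f ^^ k) z \<noteq> u"
  shows "settles (f(u := x)) z \<longleftrightarrow> settles f z" and "sink (f(u := x)) z = sink f z"
  using assms by (simp_all add: settles_def sink_def depth_def funpow_upd_unvisited)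

lemma sink_funpow: "settles f z \<Longrightarrow> sink f ((f ^^ k) z) = sink f z \<and> settles f ((f ^^ k) z)"
  by (induction k) (auto simp: sink_step settles_step)

lemma unvisited_if_sink_neq:
  assumes "settles f z" "sink f z \<noteq> sink f u"
  shows "\<forall>k. (f ^^ k) z \<noteq> u"
  using assms sink_funpow by metis

lemma depth_funpow_le: "settles f z \<Longrightarrow> depth f ((f ^^ k) z) \<le> depth f z"
proof (induction k)
  case (Suc k)
  have "settles f ((f ^^ k) z)"
    using sink_funpow[OF Suc.prems] ..
  then have "depth f (f ((f ^^ k) z)) \<le> depth f ((f ^^ k) z)"
    by (rule depth_step_le)
  with Suc show ?case by simp
qed simp

text \<open>Depth never increases along an orbit, and the step from \<open>u\<close>, which is not fixed, decreases it.\<close>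

lemma no_return:
  assumes "settles f u" "f u \<noteq> u"
  shows "\<forall>k. (f ^^ k) (f u) \<noteq> u"
proof (intro allI notI)
  fix k assume "(f ^^ k) (f u) = u"
  then have "depth f u \<le> depth f (f u)"
    using depth_funpow_le[of f "f u" k] assms by (simp add: settles_step)
  then show False
    using assms by (simp add: depth_step)
qed

text \<open>A new arc at \<open>u\<close> can only destroy the forest by closing a cycle through \<open>u\<close>, which requires that
  its head leads back to \<open>u\<close>. The value \<open>x = u\<close> turns \<open>u\<close> into a root.\<close>

lemma rooted_map_upd:
  assumes f: "rooted_map f" and x: "x = u \<or> (\<forall>k. (f ^^ k) x \<noteq> u)"
  shows "rooted_map (f(u := x))"
  unfolding rooted_map_def
proof
  fix z
  let ?f' = "f(u := x)"
  have u: "settles ?f' u"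
  proof (cases "x = u")
    case False
    then have "settles ?f' x"
      using f x by (auto simp: unvisited_upd rooted_map_def)
    then show ?thesis
      using settles_step[of ?f' u] by simp
  qed (simp add: settles_fixed)
  have "settles f z"
    using f by (simp add: rooted_map_def)
  then show "settles ?f' z"
  proof (induction rule: settles_induct)
    case (fixed z)
    then have "z \<noteq> u \<Longrightarrow> ?f' z = z" by simp
    then show ?case
      using u settles_fixed[of ?f' z] by blast
  next
    case (step z)
    have "?f' z = f z" if "z \<noteq> u"
      using that by simp
    then show ?case
      using u step settles_step[of ?f' z] by metis
  qed
qed

section \<open>Moving one arc of a forest\<close>

definition rooted_maps :: "'v set \<Rightarrow> ('v \<Rightarrow> 'v) set" where
  "rooted_maps R = {f. rooted_map f \<and> {x. f x = x} = R}"

lemma rooted_maps_settles: "f \<in> rooted_maps R \<Longrightarrow> settles f x"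
  by (simp add: rooted_maps_def rooted_map_def)

lemma rooted_maps_fixed_iff: "f \<in> rooted_maps R \<Longrightarrow> f x = x \<longleftrightarrow> x \<in> R"
  by (auto simp: rooted_maps_def)

lemma rooted_maps_sink: "f \<in> rooted_maps R \<Longrightarrow> sink f x \<in> R"
  using fixed_sink rooted_maps_settles rooted_maps_fixed_iff by metis

lemma rooted_maps_sink_root: "f \<in> rooted_maps R \<Longrightarrow> r \<in> R \<Longrightarrow> sink f r = r"
  using sink_fixed rooted_maps_fixed_iff by metis

text \<open>Redirecting \<open>u\<close> into a different tree: the path from \<open>x\<close> to its root avoids \<open>u\<close>, because it ends
  at another root, and so does the path from the old parent \<open>f u\<close>, because there are no cycles.
  Thus \<open>u\<close> changes the tree while its old parent stays, which makes the operation
  reversible. If \<open>u\<close> is a root, its whole tree is grafted below \<open>x\<close>.\<close>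

lemma redirect:
  assumes f: "f \<in> rooted_maps R" and ne: "sink f x \<noteq> sink f u"
  shows "f(u := x) \<in> rooted_maps (R - {u})"
    and "sink (f(u := x)) u = sink f x"
    and "u \<notin> R \<Longrightarrow> sink (f(u := x)) (f u) = sink f u"
proof -
  have far: "\<forall>k. (f ^^ k) x \<noteq> u"
    using unvisited_if_sink_neq[OF rooted_maps_settles[OF f] ne] .
  have r: "rooted_map (f(u := x))"
    using rooted_map_upd[of f x u] f far by (simp add: rooted_maps_def)
  then show "f(u := x) \<in> rooted_maps (R - {u})"
    using f ne by (auto simp: rooted_maps_def split: if_splits)
  have x: "sink (f(u := x)) x = sink f x"
    using far by (rule unvisited_upd)
  show "sink (f(u := x)) u = sink f x"
    using sink_step[of "f(u := x)" u] r x by (simp add: rooted_map_def)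
  assume "u \<notin> R"
  then have "\<forall>k. (f ^^ k) (f u) \<noteq> u"
    using no_return rooted_maps_settles rooted_maps_fixed_iff f by metis
  then have "sink (f(u := x)) (f u) = sink f (f u)"
    by (rule unvisited_upd)
  then show "sink (f(u := x)) (f u) = sink f u"
    using sink_step rooted_maps_settles[OF f] by metis
qed

text \<open>The inverse of grafting: the vertices that lead to \<open>u\<close> become a tree of their own. The old parent of
  \<open>u\<close> is not among them, as there are no cycles.\<close>

lemma prune:
  assumes f: "f \<in> rooted_maps R" and "u \<notin> R"
  shows "f(u := u) \<in> rooted_maps (insert u R)"
    and "sink (f(u := u)) (f u) = sink f u"
proof -
  have "rooted_map (f(u := u))"
    using rooted_map_upd[of f u u] f by (simp add: rooted_maps_def)
  then show "f(u := u) \<in> rooted_maps (insert u R)"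
    using f by (auto simp: rooted_maps_def)
  have "\<forall>k. (f ^^ k) (f u) \<noteq> u"
    using no_return rooted_maps_settles rooted_maps_fixed_iff assms by metis
  then have "sink (f(u := u)) (f u) = sink f (f u)"
    by (rule unvisited_upd)
  then show "sink (f(u := u)) (f u) = sink f u"
    using sink_step rooted_maps_settles[OF f] by metis
qed

definition map_weight :: "('v::finite \<times> 'v \<Rightarrow> real) \<Rightarrow> ('v \<Rightarrow> 'v) \<Rightarrow> real" where
  "map_weight \<omega> f = (\<Prod>x | f x \<noteq> x. \<omega> (x, f x))"

lemma map_weight_split:
  "map_weight \<omega> f =
     (if f u = u then 1 else \<omega> (u, f u)) * (\<Prod>x | x \<noteq> u \<and> f x \<noteq> x. \<omega> (x, f x))"
proof (cases "f u = u")
  case True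
  then have "{x. f x \<noteq> x} = {x. x \<noteq> u \<and> f x \<noteq> x}" by auto
  then show ?thesis using True by (simp add: map_weight_def)
next
  case False
  then have "{x. f x \<noteq> x} = insert u {x. x \<noteq> u \<and> f x \<noteq> x}" by auto
  then show ?thesis using False by (simp add: map_weight_def)
qed

text \<open>Only the factor at \<open>u\<close> changes. In this symmetric form, where a root contributes the factor 1,
  one equation covers redirecting, grafting and pruning.\<close>

lemma map_weight_upd:
  "(if x = u then 1 else \<omega> (u, x)) * map_weight \<omega> f =
   (if f u = u then 1 else \<omega> (u, f u)) * map_weight \<omega> (f(u := x))"
proof -
  have "(\<Prod>z | z \<noteq> u \<and> (f(u := x)) z \<noteq> z. \<omega> (z, (f(u := x)) z)) =
        (\<Prod>z | z \<noteq> u \<and> f z \<noteq> z. \<omega> (z, f z))"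
    by (rule prod.cong) auto
  then show ?thesis
    using map_weight_split[of \<omega> f u] map_weight_split[of \<omega> "f(u := x)" u] by simp
qed

section \<open>The Laplacian of the two-root forest weights\<close>

definition map_tree_weight :: "('v::finite \<times> 'v \<Rightarrow> real) \<Rightarrow> 'v \<Rightarrow> real" where
  "map_tree_weight \<omega> w = (\<Sum>f\<in>rooted_maps {w}. map_weight \<omega> f)"

text \<open>Up to the normalisation by the weight of all forests with roots \<open>v\<close> and \<open>w\<close>, this is the
  probability that the random walk started at \<open>u\<close> hits \<open>v\<close> before \<open>w\<close>.\<close>

definition hitting :: "('v::finite \<times> 'v \<Rightarrow> real) \<Rightarrow> 'v \<Rightarrow> 'v \<Rightarrow> 'v \<Rightarrow> real" where
  "hitting \<omega> v w u = (\<Sum>f | f \<in> rooted_maps {v, w} \<and> sink f u = v. map_weight \<omega> f)"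

text \<open>The contributions to the Laplacian at \<open>u\<close> of the arcs that lead from the tree of \<open>a\<close>, where \<open>u\<close>
  lies, to the tree of \<open>b\<close>.\<close>

definition crossing :: "('v::finite \<times> 'v \<Rightarrow> real) \<Rightarrow> 'v \<Rightarrow> 'v \<Rightarrow> 'v \<Rightarrow> real" where
  "crossing \<omega> a b u =
     (\<Sum>(f, x) | f \<in> rooted_maps {a, b} \<and> sink f u = a \<and> sink f x = b.
        \<omega> (u, x) * map_weight \<omega> f)"

text \<open>Exchanging the arc \<open>(u, f u)\<close> of the forest with the extra arc \<open>(u, x)\<close> is an involution: it
  preserves the product of all weights and moves \<open>u\<close> from one tree to the other.\<close>

lemma crossing_swap:
  assumes ne: "a \<noteq> b" and u: "u \<notin> {a, b}"
  shows "crossing \<omega> a b u = crossing \<omega> b a u"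
proof -
  define \<Phi> where "\<Phi> = (\<lambda>(f :: 'a \<Rightarrow> 'a, x). (f(u := x), f u))"
  have inv: "\<Phi> (\<Phi> p) = p" for p
    by (cases p) (simp add: \<Phi>_def)
  have maps: "\<Phi> p \<in> {(f, x). f \<in> rooted_maps {b, a} \<and> sink f u = b \<and> sink f x = a}"
    if "p \<in> {(f, x). f \<in> rooted_maps {a, b} \<and> sink f u = a \<and> sink f x = b}" "a \<noteq> b" "u \<notin> {a, b}"
    for p a b
    using that redirect[of "fst p" "{a, b}" "snd p" u]
    by (auto simp: \<Phi>_def split_beta insert_commute)
  have wt: "(case \<Phi> p of (f, x) \<Rightarrow> \<omega> (u, x) * map_weight \<omega> f) =
            (case p of (f, x) \<Rightarrow> \<omega> (u, x) * map_weight \<omega> f)"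
    if "p \<in> {(f, x). f \<in> rooted_maps {a, b} \<and> sink f u = a \<and> sink f x = b}" for p
  proof -
    obtain f x where p: "p = (f, x)" by (cases p)
    have "f u \<noteq> u"
      using that u p rooted_maps_fixed_iff by fastforce
    moreover have "x \<noteq> u" using that ne p by auto
    ultimately show ?thesis
      using map_weight_upd[of x u \<omega> f] by (simp add: p \<Phi>_def)
  qed
  show ?thesis
    unfolding crossing_def
  proof (rule sum.reindex_bij_witness[of _ \<Phi> \<Phi>], goal_cases)
    case (2 p) then show ?case using maps[OF 2 assms] by simp
  next
    case (4 p) then show ?case using maps[OF 4] assms by (simp add: insert_commute)
  qed (simp_all add: inv wt)
qed

text \<open>A forest together with an arc from its root \<open>a\<close> into the tree of \<open>b\<close> is a spanning tree with
  root \<open>b\<close>; the forest is recovered by removing the arc that leaves \<open>a\<close>.\<close>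

lemma crossing_at_root:
  assumes "a \<noteq> b"
  shows "crossing \<omega> a b a = map_tree_weight \<omega> b"
  unfolding crossing_def map_tree_weight_def
proof (rule sum.reindex_bij_witness
    [of _ "\<lambda>g. (g(a := a), g a)" "\<lambda>(f, x). f(a := x)"], goal_cases)
  case (1 p)
  then show ?case
    using rooted_maps_fixed_iff by (fastforce simp: fun_upd_idem_iff)
next
  case (2 p)
  then obtain f x where p: "p = (f, x)" "f \<in> rooted_maps {a, b}" "sink f a = a" "sink f x = b"
    by auto
  then have "sink f x \<noteq> sink f a"
    using assms by simp
  from redirect(1)[OF p(2) this] show ?case
    using p assms by (simp add: insert_Diff_if)
next
  case (3 g)
  then show ?case by simp
next
  case (4 g)
  have "sink g a = b"
    using rooted_maps_sink[OF 4] by simp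
  then show ?case
    using prune[OF 4, of a] assms sink_fixed[of "g(a := a)" a] by simp
next
  case (5 p)
  then obtain f x where p: "p = (f, x)" "f \<in> rooted_maps {a, b}" "sink f a = a" "sink f x = b"
    by auto
  then have "f a = a"
    using rooted_maps_fixed_iff[OF p(2)] by simp
  moreover have "x \<noteq> a"
    using p assms by auto
  ultimately show ?case
    using p(1) map_weight_upd[of x a \<omega> f] by simp
qed

lemma crossing_at_far_root:
  assumes "a \<noteq> b"
  shows "crossing \<omega> b a a = 0"
proof -
  have "sink f a \<noteq> b" if "f \<in> rooted_maps {b, a}" for f
    using rooted_maps_sink_root[OF that, of a] assms by simp
  then have "{(f, x). f \<in> rooted_maps {b, a} \<and> sink f a = b \<and> sink f x = a} = {}"
    by auto
  from arg_cong[OF this, of "sum (\<lambda>(f, x). \<omega> (a, x) * map_weight \<omega> f)"] show ?thesis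
    by (simp add: crossing_def)
qed

text \<open>In \<open>h(u) - h(x)\<close> the forests with \<open>u\<close> and \<open>x\<close> in the same tree cancel, which leaves the
  difference of the two crossing weights.\<close>

lemma hitting_laplacian:
  assumes "v \<noteq> w"
  shows "(\<Sum>x\<in>UNIV. \<omega> (u, x) * (hitting \<omega> v w u - hitting \<omega> v w x)) =
    (if u = v then map_tree_weight \<omega> w else 0) - (if u = w then map_tree_weight \<omega> v else 0)"
proof -
  let ?S = "rooted_maps {v, w}"
  have hit: "hitting \<omega> v w z = (\<Sum>f\<in>?S. if sink f z = v then map_weight \<omega> f else 0)" for z
    unfolding hitting_def by (simp add: sum.inter_filter)
  have cross: "crossing \<omega> a b u =
      (\<Sum>x\<in>UNIV. \<Sum>f\<in>?S. if sink f u = a \<and> sink f x = b then \<omega> (u, x) * map_weight \<omega> f else 0)"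
    if "{a, b} = {v, w}" for a b
  proof -
    have "crossing \<omega> a b u = (\<Sum>(f, x)\<in>?S \<times> UNIV.
        if sink f u = a \<and> sink f x = b then \<omega> (u, x) * map_weight \<omega> f else 0)"
      unfolding crossing_def that by (rule sum.mono_neutral_cong_left) (auto split: if_splits)
    then show ?thesis
      by (subst sum.swap) (simp add: sum.cartesian_product)
  qed
  have sinks: "sink f z = v \<or> sink f z = w" if "f \<in> ?S" for f z
    using rooted_maps_sink[OF that] by blast
  have "(\<Sum>x\<in>UNIV. \<omega> (u, x) * (hitting \<omega> v w u - hitting \<omega> v w x)) =
    crossing \<omega> v w u - crossing \<omega> w v u"
    unfolding hit cross[OF refl] cross[OF insert_commute] sum_subtractf[symmetric] sum_distrib_left
    by (intro sum.cong refl) (use sinks assms in \<open>auto split: if_splits\<close>)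
  also have "\<dots> = (if u = v then map_tree_weight \<omega> w else 0) - (if u = w then map_tree_weight \<omega> v else 0)"
    using assms crossing_swap[of v w u \<omega>]
    by (auto simp: crossing_at_root crossing_at_far_root)
  finally show ?thesis .
qed

section \<open>The pseudoinverse of the Laplacian\<close>

lemma laplacian_nth:
  "laplacian \<omega> $ u $ x = (if u = x then \<Sum>y\<in>UNIV. \<omega> (u, y) else 0) - \<omega> (u, x)"
  by (simp add: laplacian_def degree_matrix_def adjacency_def degree_out_def)

lemma sum_laplacian_row:
  "(\<Sum>x\<in>UNIV. laplacian \<omega> $ u $ x * g x) = (\<Sum>x\<in>UNIV. \<omega> (u, x) * (g u - g x))"
proof -
  have "(\<Sum>x\<in>UNIV. laplacian \<omega> $ u $ x * g x) =
    (\<Sum>x\<in>UNIV. if u = x then (\<Sum>y\<in>UNIV. \<omega> (u, y)) * g x else 0) - (\<Sum>x\<in>UNIV. \<omega> (u, x) * g x)"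
    unfolding laplacian_nth sum_subtractf[symmetric]
    by (intro sum.cong refl) (simp add: left_diff_distrib)
  also have "\<dots> = (\<Sum>x\<in>UNIV. \<omega> (u, x) * g u) - (\<Sum>x\<in>UNIV. \<omega> (u, x) * g x)"
    by (simp add: sum_distrib_right)
  finally show ?thesis
    by (simp add: right_diff_distrib sum_subtractf)
qed

text \<open>Maximum principle: where \<open>g\<close> attains its maximum, all terms of the vanishing sum are nonnegative,
  so \<open>g\<close> takes the same value at all out-neighbours, and strong connectivity spreads it everywhere.\<close>

lemma harmonic_constant:
  fixes \<omega> :: "'v::finite \<times> 'v \<Rightarrow> real"
  assumes nonneg: "\<And>e. \<omega> e \<ge> 0"
    and conn: "\<And>u v. (u, v) \<in> {e. \<omega> e > 0}\<^sup>*"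
    and harm: "\<And>u. (\<Sum>x\<in>UNIV. \<omega> (u, x) * (g u - g x)) = 0"
  shows "g u = g v"
proof -
  define m where "m = Max (range g)"
  have le: "g x \<le> m" for x
    by (simp add: m_def)
  have "m \<in> range g"
    unfolding m_def by (rule Max_in) auto
  then obtain a where a: "g a = m"
    by auto
  have "g x = m" for x
    using conn[of a x]
  proof (induction rule: rtrancl_induct)
    case (step y z)
    have "\<forall>x\<in>UNIV. \<omega> (y, x) * (g y - g x) = 0"
      using harm[of y] le nonneg step.IH
      by (subst sum_nonneg_eq_0_iff[symmetric]) auto
    then have "\<omega> (y, z) * (g y - g z) = 0"
      by blast
    then show ?case
      using step by auto
  qed (rule a)
  then show ?thesis by simp
qed

text \<open>Moving along arcs that decrease the distance to \<open>w\<close> gives a spanning tree with root \<open>w\<close> all of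
  whose arcs have positive weight.\<close>

lemma map_tree_weight_pos:
  fixes \<omega> :: "'v::finite \<times> 'v \<Rightarrow> real"
  assumes nonneg: "\<And>e. \<omega> e \<ge> 0"
    and conn: "\<And>u v. (u, v) \<in> {e. \<omega> e > 0}\<^sup>*"
  shows "map_tree_weight \<omega> w > 0"
proof -
  let ?E = "{e. \<omega> e > 0}"
  define d where "d x = (LEAST k. (x, w) \<in> ?E ^^ k)" for x
  have d: "(x, w) \<in> ?E ^^ d x" for x
  proof -
    obtain k where "(x, w) \<in> ?E ^^ k"
      using rtrancl_imp_relpow[OF conn[of x w]] by blast
    then show ?thesis
      unfolding d_def by (rule LeastI)
  qed
  have closer: "\<exists>y. \<omega> (x, y) > 0 \<and> d y < d x" if x: "x \<noteq> w" for x
  proof (cases "d x")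
    case 0
    then show ?thesis using d[of x] x by simp
  next
    case (Suc m)
    then have "(x, w) \<in> ?E ^^ Suc m"
      using d[of x] by simp
    from relpow_Suc_D2[OF this] obtain y where y: "(x, y) \<in> ?E" "(y, w) \<in> ?E ^^ m"
      by blast
    then have "d y \<le> m"
      unfolding d_def by (intro Least_le)
    then show ?thesis using y Suc by auto
  qed
  define f where "f x = (if x = w then w else SOME y. \<omega> (x, y) > 0 \<and> d y < d x)" for x
  have f: "\<omega> (x, f x) > 0 \<and> d (f x) < d x" if "x \<noteq> w" for x
    using someI_ex[OF closer[OF that]] that by (simp add: f_def)
  have fw: "f w = w"
    by (simp add: f_def)
  have fixed: "f x = x \<longleftrightarrow> x = w" for x
    using f[of x] fw by (metis less_irrefl)
  have "settles f x" for x
  proof (induction "d x" arbitrary: x rule: less_induct)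
    case less
    then show ?case
      using f[of x] fixed[of x] settles_fixed[of f x] settles_step[of f x] by blast
  qed
  then have "rooted_map f"
    unfolding rooted_map_def by blast
  then have "f \<in> rooted_maps {w}"
    by (simp add: rooted_maps_def fixed)
  moreover have "map_weight \<omega> f > 0"
    unfolding map_weight_def using f fixed by (intro prod_pos) auto
  moreover have "map_weight \<omega> g \<ge> 0" for g
    unfolding map_weight_def using nonneg by (intro prod_nonneg) auto
  ultimately show ?thesis
    unfolding map_tree_weight_def by (intro sum_pos2[of _ f]) auto
qed

text \<open>The Markov chain tree theorem. Instead of a second bijection, it uses a left null vector \<open>s\<close>,
  which exists because the rows of the Laplacian sum to zero: pairing \<open>s\<close> with
  \<open>L h\<^sub>v\<^sub>w = \<tau>\<^sub>w e\<^sub>v - \<tau>\<^sub>v e\<^sub>w\<close> gives \<open>s\<^sub>v \<tau>\<^sub>w = s\<^sub>w \<tau>\<^sub>v\<close> for all \<open>v\<close> and \<open>w\<close>, so \<open>s\<close> is a nonzero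
  multiple of the tree weights.\<close>

lemma sum_map_tree_weight_laplacian:
  fixes \<omega> :: "'v::finite \<times> 'v \<Rightarrow> real"
  assumes pos: "\<And>w. map_tree_weight \<omega> w > 0"
  shows "(\<Sum>u\<in>UNIV. map_tree_weight \<omega> u * laplacian \<omega> $ u $ x) = 0"
proof -
  let ?L = "laplacian \<omega>" and ?\<tau> = "map_tree_weight \<omega>"
  have "?L *v 1 = 0"
    using sum_laplacian_row[of \<omega> _ "\<lambda>_. 1"] by (simp add: vec_eq_iff matrix_vector_mult_def)
  moreover have "(1 :: real ^ 'v) \<noteq> 0"
    by (simp add: vec_eq_iff)
  ultimately have "\<nexists>B. B ** ?L = mat 1"
    by (auto simp: matrix_left_invertible_ker)
  then have "\<nexists>B. B ** transpose ?L = mat 1"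
    by (metis matrix_left_right_inverse matrix_transpose_mul transpose_mat transpose_transpose)
  then obtain s where "transpose ?L *v s = 0" and s0: "s \<noteq> 0"
    by (auto simp: matrix_left_invertible_ker)
  then have s: "(\<Sum>u\<in>UNIV. s $ u * ?L $ u $ y) = 0" for y
    by (simp add: vec_eq_iff matrix_vector_mult_def transpose_def mult.commute)
  have proportional: "s $ v * ?\<tau> w = s $ w * ?\<tau> v" for v w
  proof (cases "v = w")
    case False
    have "0 = (\<Sum>y\<in>UNIV. (\<Sum>u\<in>UNIV. s $ u * ?L $ u $ y) * hitting \<omega> v w y)"
      by (simp add: s)
    also have "\<dots> = (\<Sum>u\<in>UNIV. s $ u * (\<Sum>y\<in>UNIV. ?L $ u $ y * hitting \<omega> v w y))"
      by (simp add: sum_distrib_left sum_distrib_right mult.assoc) (rule sum.swap)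
    also have "\<dots> = (\<Sum>u\<in>UNIV. (if u = v then s $ u * ?\<tau> w else 0) - (if u = w then s $ u * ?\<tau> v else 0))"
      unfolding sum_laplacian_row hitting_laplacian[OF False] by (intro sum.cong refl) simp
    also have "\<dots> = s $ v * ?\<tau> w - s $ w * ?\<tau> v"
      by (simp add: sum_subtractf)
    finally show ?thesis by simp
  qed simp
  obtain w where w: "s $ w \<noteq> 0"
    using s0 by (auto simp: vec_eq_iff)
  have "?\<tau> u * ?L $ u $ x = ?\<tau> w / s $ w * (s $ u * ?L $ u $ x)" for u
    using proportional[of u w] w by (simp add: field_simps)
  then have "(\<Sum>u\<in>UNIV. ?\<tau> u * ?L $ u $ x) = (\<Sum>u\<in>UNIV. ?\<tau> w / s $ w * (s $ u * ?L $ u $ x))"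
    by (rule sum.cong[OF refl])
  also have "\<dots> = ?\<tau> w / s $ w * (\<Sum>u\<in>UNIV. s $ u * ?L $ u $ x)"
    by (rule sum_distrib_left[symmetric])
  finally show ?thesis
    by (simp add: s)
qed

text \<open>Subtracting the mean makes the columns sum to zero without changing the Laplacian of the column.\<close>

definition hitting_green :: "('v::finite \<times> 'v \<Rightarrow> real) \<Rightarrow> 'v \<Rightarrow> 'v \<Rightarrow> real" where
  "hitting_green \<omega> u v =
     (\<Sum>w\<in>UNIV - {v}. map_tree_weight \<omega> w *
        (hitting \<omega> v w u - (\<Sum>z\<in>UNIV. hitting \<omega> v w z) / real CARD('v)))
     / (\<Sum>w\<in>UNIV. (map_tree_weight \<omega> w)\<^sup>2)"

lemma sum_hitting_green: "(\<Sum>u\<in>UNIV. hitting_green \<omega> u v) = 0"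
proof -
  have "(\<Sum>u\<in>UNIV. \<Sum>w\<in>UNIV - {v}. map_tree_weight \<omega> w *
        (hitting \<omega> v w u - (\<Sum>z\<in>UNIV. hitting \<omega> v w z) / real CARD('a))) = 0"
    by (subst sum.swap) (simp add: sum_distrib_left[symmetric] sum_subtractf)
  then show ?thesis
    unfolding hitting_green_def by (simp add: sum_divide_distrib[symmetric])
qed

text \<open>Weighting \<open>\<tau>\<^sub>w e\<^sub>v - \<tau>\<^sub>v e\<^sub>w\<close> with \<open>\<tau>\<^sub>w\<close> and summing over \<open>w \<noteq> v\<close> gives
  \<open>|\<tau>|\<^sup>2 e\<^sub>v - \<tau>\<^sub>v \<tau>\<close>.\<close>

lemma laplacian_hitting_green:
  assumes "\<And>w. map_tree_weight \<omega> w > 0"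
  shows "(\<Sum>x\<in>UNIV. laplacian \<omega> $ u $ x * hitting_green \<omega> x v) =
    (if u = v then 1 else 0) -
    map_tree_weight \<omega> u * map_tree_weight \<omega> v / (\<Sum>w\<in>UNIV. (map_tree_weight \<omega> w)\<^sup>2)"
proof -
  let ?\<tau> = "map_tree_weight \<omega>"
  let ?N = "\<Sum>w\<in>UNIV. (?\<tau> w)\<^sup>2"
  let ?m = "\<lambda>w. (\<Sum>z\<in>UNIV. hitting \<omega> v w z) / real CARD('a)"
  have "?N > 0"
    by (intro sum_pos zero_less_power assms) auto
  have diff: "hitting_green \<omega> u v - hitting_green \<omega> x v =
      (\<Sum>w\<in>UNIV - {v}. ?\<tau> w * (hitting \<omega> v w u - hitting \<omega> v w x)) / ?N" for x
    unfolding hitting_green_def diff_divide_distrib[symmetric] sum_subtractf[symmetric]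
    by (simp add: algebra_simps)
  have "(\<Sum>x\<in>UNIV. laplacian \<omega> $ u $ x * hitting_green \<omega> x v) =
    (\<Sum>x\<in>UNIV. \<Sum>w\<in>UNIV - {v}. ?\<tau> w * (\<omega> (u, x) * (hitting \<omega> v w u - hitting \<omega> v w x))) / ?N"
    unfolding sum_laplacian_row diff
    by (simp add: sum_divide_distrib sum_distrib_left mult.left_commute)
  also have "\<dots> = (\<Sum>w\<in>UNIV - {v}. ?\<tau> w *
      (\<Sum>x\<in>UNIV. \<omega> (u, x) * (hitting \<omega> v w u - hitting \<omega> v w x))) / ?N"
    by (subst sum.swap) (simp add: sum_distrib_left)
  also have "(\<Sum>w\<in>UNIV - {v}. ?\<tau> w *
      (\<Sum>x\<in>UNIV. \<omega> (u, x) * (hitting \<omega> v w u - hitting \<omega> v w x))) =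
    (\<Sum>w\<in>UNIV - {v}. (if u = v then (?\<tau> w)\<^sup>2 else 0) - (if u = w then ?\<tau> w * ?\<tau> v else 0))"
    by (intro sum.cong refl) (auto simp: hitting_laplacian power2_eq_square)
  also have "\<dots> = (if u = v then ?N - (?\<tau> v)\<^sup>2 else - (?\<tau> u * ?\<tau> v))"
    by (auto simp: sum_subtractf sum_diff1 intro!: sum.neutral)
  also have "\<dots> = (if u = v then ?N else 0) - ?\<tau> u * ?\<tau> v"
    by (simp add: power2_eq_square)
  finally show ?thesis
    using \<open>?N > 0\<close> by (simp add: diff_divide_distrib)
qed

text \<open>The products in both orders are the orthogonal projections along \<open>\<tau>\<close> and along the constant
  vectors, hence symmetric. The second one comes from the first: the columns of \<open>X L - I\<close> are in the
  kernel of \<open>L\<close>, so they are constant, and the zero column sums of \<open>X\<close> fix the constant.\<close>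

lemma green_hitting:
  fixes \<omega> :: "'v::finite \<times> 'v \<Rightarrow> real"
  assumes nonneg: "\<And>e. \<omega> e \<ge> 0"
    and conn: "\<And>u v. (u, v) \<in> {e. \<omega> e > 0}\<^sup>*"
  shows "green \<omega> $ u $ v = hitting_green \<omega> u v"
proof -
  let ?L = "laplacian \<omega>" and ?\<tau> = "map_tree_weight \<omega>" and ?n = "real CARD('v)"
  define N where "N = (\<Sum>w\<in>UNIV. (?\<tau> w)\<^sup>2)"
  define X where "X = (\<chi> u v. hitting_green \<omega> u v)"
  have pos: "?\<tau> w > 0" for w
    using assms by (rule map_tree_weight_pos)
  have LX: "(?L ** X) $ u $ v = (if u = v then 1 else 0) - ?\<tau> u * ?\<tau> v / N" for u v
    using laplacian_hitting_green[OF pos, of u v]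
    by (simp add: matrix_matrix_mult_def X_def N_def)
  have LXL: "?L ** X ** ?L = ?L"
  proof -
    have "(?L ** X ** ?L) $ u $ v = ?L $ u $ v" for u v
    proof -
      have "(?L ** X ** ?L) $ u $ v = (\<Sum>x\<in>UNIV. (?L ** X) $ u $ x * ?L $ x $ v)"
        by (simp add: matrix_matrix_mult_def[of "?L ** X"])
      also have "\<dots> = (\<Sum>x\<in>UNIV. (if u = x then ?L $ x $ v else 0) - ?\<tau> u / N * (?\<tau> x * ?L $ x $ v))"
        unfolding LX by (intro sum.cong refl) (simp add: left_diff_distrib)
      also have "\<dots> = ?L $ u $ v - ?\<tau> u / N * (\<Sum>x\<in>UNIV. ?\<tau> x * ?L $ x $ v)"
        by (simp add: sum_subtractf sum_distrib_left)
      finally show ?thesis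
        by (simp add: sum_map_tree_weight_laplacian[OF pos])
    qed
    then show ?thesis by (simp add: vec_eq_iff)
  qed
  have XL: "(X ** ?L) $ u $ v = (if u = v then 1 else 0) - 1 / ?n" for u v
  proof -
    \<comment> \<open>The column \<open>v\<close> of \<open>X L - I\<close>, which \<open>L\<close> annihilates because \<open>L X L = L\<close>.\<close>
    define g where "g x = (X ** ?L) $ x $ v - (if x = v then 1 else 0)" for x
    have "(\<Sum>x\<in>UNIV. \<omega> (y, x) * (g y - g x)) = 0" for y
    proof -
      have "(\<Sum>x\<in>UNIV. ?L $ y $ x * g x) =
        (\<Sum>x\<in>UNIV. ?L $ y $ x * (X ** ?L) $ x $ v) - (\<Sum>x\<in>UNIV. if x = v then ?L $ y $ x else 0)"
        unfolding g_def sum_subtractf[symmetric]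
        by (intro sum.cong refl) (simp add: right_diff_distrib)
      also have "(\<Sum>x\<in>UNIV. ?L $ y $ x * (X ** ?L) $ x $ v) = (?L ** (X ** ?L)) $ y $ v"
        by (simp add: matrix_matrix_mult_def[of ?L "X ** ?L"])
      finally show ?thesis
        unfolding sum_laplacian_row matrix_mul_assoc LXL by simp
    qed
    then have const: "g x = g u" for x
      using nonneg conn by (intro harmonic_constant[of \<omega>])
    have "(\<Sum>x\<in>UNIV. (X ** ?L) $ x $ v) = (\<Sum>y\<in>UNIV. (\<Sum>x\<in>UNIV. X $ x $ y) * ?L $ y $ v)"
      unfolding matrix_matrix_mult_def by (simp add: sum_distrib_right) (rule sum.swap)
    also have "\<dots> = 0"
      by (simp add: X_def sum_hitting_green)
    finally have "0 = (\<Sum>x\<in>UNIV. (X ** ?L) $ x $ v)" ..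
    also have "\<dots> = (\<Sum>x\<in>UNIV. g u + (if x = v then 1 else 0))"
    proof (rule sum.cong[OF refl])
      fix x
      have "(X ** ?L) $ x $ v = g x + (if x = v then 1 else 0)"
        by (simp add: g_def)
      also have "g x = g u"
        by (rule const)
      finally show "(X ** ?L) $ x $ v = g u + (if x = v then 1 else 0)" .
    qed
    also have "\<dots> = ?n * g u + 1"
      by (simp add: sum.distrib)
    finally have "?n * g u = - 1"
      by linarith
    then have "g u = - 1 / ?n"
      by (simp add: field_simps)
    then show ?thesis
      by (simp add: g_def algebra_simps)
  qed
  have XLX: "X ** ?L ** X = X"
  proof -
    have "(X ** ?L ** X) $ u $ v = X $ u $ v" for u v
    proof -
      have "(X ** ?L ** X) $ u $ v = (\<Sum>x\<in>UNIV. (X ** ?L) $ u $ x * X $ x $ v)"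
        by (simp add: matrix_matrix_mult_def[of "X ** ?L"])
      also have "\<dots> = (\<Sum>x\<in>UNIV. (if u = x then X $ x $ v else 0) - 1 / ?n * X $ x $ v)"
        unfolding XL by (intro sum.cong refl) (simp add: left_diff_distrib)
      also have "\<dots> = X $ u $ v - 1 / ?n * (\<Sum>x\<in>UNIV. X $ x $ v)"
        by (simp add: sum_subtractf sum_distrib_left)
      finally show ?thesis
        by (simp add: X_def sum_hitting_green)
    qed
    then show ?thesis by (simp add: vec_eq_iff)
  qed
  have "is_pseudoinverse ?L X"
    unfolding is_pseudoinverse_def using LXL XLX
    by (auto simp: vec_eq_iff transpose_def LX XL mult.commute)
  then have "green \<omega> = X"
    unfolding green_def by (rule pseudoinverse_eqI)
  then show ?thesis
    by (simp add: X_def)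
qed

section \<open>Spanning rooted forests as self-maps\<close>

definition map_graph :: "('v \<Rightarrow> 'v) \<Rightarrow> 'v pair_pre_digraph" where
  "map_graph f = \<lparr>pverts = UNIV, parcs = {(x, f x) | x. f x \<noteq> x}\<rparr>"

definition map_component :: "('v \<Rightarrow> 'v) \<Rightarrow> 'v \<Rightarrow> 'v pair_pre_digraph" where
  "map_component f r =
     (let S = {x. sink f x = r} in \<lparr>pverts = S, parcs = parcs (map_graph f) \<inter> S \<times> S\<rparr>)"

lemma pverts_map_graph [simp]: "pverts (map_graph f) = UNIV"
  by (simp add: map_graph_def)

lemma parcs_map_graph_iff [simp]: "(x, y) \<in> parcs (map_graph f) \<longleftrightarrow> y = f x \<and> f x \<noteq> x"
  by (auto simp: map_graph_def)

lemma pverts_map_component [simp]: "pverts (map_component f r) = {x. sink f x = r}"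
  by (simp add: map_component_def Let_def)

lemma parcs_map_component_iff:
  assumes "rooted_map f"
  shows "(x, y) \<in> parcs (map_component f r) \<longleftrightarrow> sink f x = r \<and> y = f x \<and> f x \<noteq> x"
  using assms by (auto simp: map_component_def Let_def sink_step rooted_map_def)

lemma pair_digraph_map_graph: "pair_digraph (map_graph (f :: 'v::finite \<Rightarrow> 'v))"
  by unfold_locales (auto simp: map_graph_def)

lemma inj_map_graph: "inj map_graph"
proof (rule injI, rule ext)
  fix f g :: "'v \<Rightarrow> 'v" and x
  assume eq: "map_graph f = map_graph g"
  show "f x = g x"
    using parcs_map_graph_iff[of x _ f] parcs_map_graph_iff[of x _ g] unfolding eq by metis
qed

lemma weight_map_graph: "weight \<omega> (map_graph f) = map_weight \<omega> f"
proof -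
  have "parcs (map_graph f) = (\<lambda>x. (x, f x)) ` {x. f x \<noteq> x}"
    by (auto simp: map_graph_def)
  then show ?thesis
    by (simp add: weight_def map_weight_def prod.reindex inj_on_def)
qed

text \<open>In the tree of \<open>r\<close> every vertex other than \<open>r\<close> has exactly one outgoing arc and \<open>r\<close> has none, so the
  orbit is the only path to \<open>r\<close>, and \<open>r\<close> has no path to any other vertex.\<close>

lemma is_root_map_component:
  fixes f :: "'v \<Rightarrow> 'v"
  assumes f: "rooted_map f" and r: "f r = r"
  shows "is_root (map_component f r) z \<longleftrightarrow> z = r"
proof -
  let ?T = "map_component f r"
  have settles: "settles f x" for x
    using f by (simp add: rooted_map_def)
  have arc: "(x, y) \<in> parcs ?T \<longleftrightarrow> sink f x = r \<and> y = f x \<and> f x \<noteq> x" for x y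
    by (rule parcs_map_component_iff[OF f])
  interpret T: pair_wf_digraph ?T
    by unfold_locales (auto simp: arc sink_step settles)
  have "reachable (with_proj ?T) x r" if "sink f x = r" for x
    using settles[of x] that
  proof (induction rule: settles_induct)
    case (fixed x)
    then show ?case by (simp add: sink_fixed)
  next
    case (step x)
    then have "reachable (with_proj ?T) (f x) r"
      by (simp add: sink_step settles)
    moreover have "(x, f x) \<in> parcs ?T"
      using step by (simp add: arc)
    ultimately show ?case
      using T.adj_reachable_trans by blast
  qed
  then have ex: "\<exists>p. T.apath x p r" if "sink f x = r" for x
    using that T.reachable_apath by blast
  have uniq: "p = q" if "T.apath x p r" "T.apath x q r" for x p q
    using that
  proof (induction p arbitrary: x q)
    case Nil
    then have "x = r" by (simp add: T.apath_Nil_iff)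
    show ?case
    proof (rule ccontr)
      assume "[] \<noteq> q"
      then obtain e q' where "q = e # q'"
        by (cases q) auto
      then have "(r, snd e) \<in> parcs ?T"
        using Nil(2) \<open>x = r\<close> by (cases e) (auto simp: T.apath_Cons_iff)
      then show False
        using r by (simp add: arc)
    qed
  next
    case (Cons e p)
    then obtain y where e: "e = (x, f x)" "f x \<noteq> x" "T.apath (f x) p r"
      by (cases e) (auto simp: T.apath_Cons_iff arc)
    then have "x \<noteq> r" using r by auto
    then obtain e' q' where q: "q = e' # q'"
      using Cons.prems(2) by (cases q) (auto simp: T.apath_Nil_iff)
    then have "e' = (x, f x)" "T.apath (f x) q' r"
      using Cons.prems(2) by (cases e'; auto simp: T.apath_Cons_iff arc)+
    then show ?case
      using Cons.IH[OF e(3)] q e(1) by simp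
  qed
  have "is_root ?T r"
    unfolding is_root_def using ex uniq r by (auto simp: sink_fixed)
  moreover have "z = r" if "is_root ?T z"
  proof -
    have "r \<in> pverts ?T"
      using r by (simp add: sink_fixed)
    then obtain p where "T.apath r p z"
      using \<open>is_root ?T z\<close> unfolding is_root_def by blast
    then show ?thesis
      using r by (cases p) (auto simp: T.apath_Nil_iff T.apath_Cons_iff arc)
  qed
  ultimately show ?thesis by blast
qed

lemma root_of_map_component:
  "rooted_map f \<Longrightarrow> f r = r \<Longrightarrow> root_of (map_component f r) = r"
  unfolding root_of_def by (rule the_equality) (simp_all add: is_root_map_component)

lemma parcs_mk_symmetric_iff:
  "(x, y) \<in> parcs (mk_symmetric (with_proj G)) \<longleftrightarrow> (x, y) \<in> parcs G \<or> (y, x) \<in> parcs G"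
  by (auto simp: parcs_mk_symmetric Bex_def split_paired_Ex)

lemma parcs_mk_symmetric_map_graph:
  "(x, y) \<in> parcs (mk_symmetric (with_proj (map_graph f))) \<longleftrightarrow>
    x \<noteq> y \<and> (y = f x \<or> x = f y)"
  by (auto simp: parcs_mk_symmetric_iff)

text \<open>An arc never leaves the tree of its tail, and two vertices of the same tree are joined through
  their common root.\<close>

lemma reachable_mk_symmetric_map_graph:
  fixes f :: "'v::finite \<Rightarrow> 'v"
  assumes f: "rooted_map f"
  shows "reachable (with_proj (mk_symmetric (with_proj (map_graph f)))) x y \<longleftrightarrow>
    sink f x = sink f y"
proof -
  let ?M = "mk_symmetric (with_proj (map_graph f))"
  interpret G: pair_digraph "map_graph f"
    by (rule pair_digraph_map_graph)
  interpret M: pair_wf_digraph ?M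
    by (rule G.wellformed_mk_symmetric)
  have settles: "settles f x" for x
    using f by (simp add: rooted_map_def)
  have to_sink: "reachable (with_proj ?M) x (sink f x)" for x
    using settles[of x]
  proof (induction rule: settles_induct)
    case (fixed x)
    then show ?case by (simp add: sink_fixed)
  next
    case (step x)
    then have "(x, f x) \<in> parcs ?M"
      by (simp add: parcs_mk_symmetric_map_graph)
    then have "reachable (with_proj ?M) x (sink f (f x))"
      using step M.adj_reachable_trans by blast
    then show ?case by (simp add: sink_step settles)
  qed
  show ?thesis
  proof
    assume "reachable (with_proj ?M) x y"
    then show "sink f x = sink f y"
    proof (induction rule: M.reachable_induct)
      case (step y z)
      have "sink f y = sink f z"
        using step(2) sink_step[OF settles] by (auto simp: parcs_mk_symmetric_map_graph)
      with step show ?case by simp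
    qed simp
  next
    assume "sink f x = sink f y"
    then have "reachable (with_proj ?M) x (sink f y)"
      using to_sink[of x] by simp
    moreover have "reachable (with_proj ?M) (sink f y) y"
      using symmetric_reachable[OF symmetric_mk_symmetric to_sink] .
    ultimately show "reachable (with_proj ?M) x y"
      by (rule M.reachable_trans)
  qed
qed

lemma weak_components_map_graph:
  fixes f :: "'v::finite \<Rightarrow> 'v"
  assumes f: "rooted_map f"
  shows "weak_components (map_graph f) = map_component f ` {x. f x = x}"
proof -
  let ?sccs = "pre_digraph.sccs_verts (with_proj (mk_symmetric (with_proj (map_graph f))))"
  have settles: "settles f x" for x
    using f by (simp add: rooted_map_def)
  have "S \<in> ?sccs \<longleftrightarrow> S \<in> (\<lambda>r. {x. sink f x = r}) ` {x. f x = x}" for S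
  proof -
    have "S \<in> ?sccs \<longleftrightarrow> S \<noteq> {} \<and> (\<forall>u\<in>S. \<forall>v. v \<in> S \<longleftrightarrow> sink f v = sink f u)"
      unfolding pre_digraph.sccs_verts_def mem_Collect_eq reachable_mk_symmetric_map_graph[OF f]
      by metis
    also have "\<dots> \<longleftrightarrow> (\<exists>r. f r = r \<and> S = {x. sink f x = r})"
    proof
      assume S: "S \<noteq> {} \<and> (\<forall>u\<in>S. \<forall>v. v \<in> S \<longleftrightarrow> sink f v = sink f u)"
      then obtain u where "u \<in> S" by blast
      with S have "S = {x. sink f x = sink f u}" by blast
      then show "\<exists>r. f r = r \<and> S = {x. sink f x = r}"
        using fixed_sink[OF settles[of u]] by blast
    next
      assume "\<exists>r. f r = r \<and> S = {x. sink f x = r}"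
      then obtain r where "f r = r" "S = {x. sink f x = r}" by blast
      moreover from this have "r \<in> S" by (simp add: sink_fixed)
      ultimately show "S \<noteq> {} \<and> (\<forall>u\<in>S. \<forall>v. v \<in> S \<longleftrightarrow> sink f v = sink f u)"
        by blast
    qed
    finally show ?thesis by auto
  qed
  then have "?sccs = (\<lambda>r. {x. sink f x = r}) ` {x. f x = x}"
    by blast
  then show ?thesis
    unfolding weak_components_def map_component_def Let_def by (simp add: image_image)
qed

lemma inj_on_map_component:
  assumes "rooted_map f"
  shows "inj_on (map_component f) {x. f x = x}"
  by (rule inj_on_inverseI[where g = root_of]) (simp add: root_of_map_component assms)

text \<open>Indexing of closed walks, in order to speak of the two neighbours of an arc on a cycle.\<close>

lemma pcas_nth_fst:
  "pcas u p v \<Longrightarrow> i < length p \<Longrightarrow> fst (p ! i) = (if i = 0 then u else snd (p ! (i - 1)))"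
  by (induction p arbitrary: u i) (auto simp: nth_Cons split: nat.split)

lemma pcas_snd_last: "pcas u p v \<Longrightarrow> p \<noteq> [] \<Longrightarrow> snd (last p) = v"
  by (induction p arbitrary: u) auto

lemma pawalk_verts_eq: "pcas u p v \<Longrightarrow> pawalk_verts u p = u # map snd p"
  by (induction p arbitrary: u) auto

text \<open>On an undirected cycle, both neighbours of a vertex of maximal depth are at most as deep, so each of
  them is its parent; but on a cycle of length at least 3 the neighbours are distinct.\<close>

lemma no_cycle_map_graph:
  fixes f :: "'v::finite \<Rightarrow> 'v"
  assumes f: "rooted_map f"
    and cycle: "pre_digraph.cycle (with_proj (mk_symmetric (with_proj (map_graph f)))) p"
  shows "length p < 3"
proof (rule ccontr)
  assume "\<not> length p < 3"
  let ?M = "mk_symmetric (with_proj (map_graph f))"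
  let ?n = "length p"
  have settles: "settles f x" for x
    using f by (simp add: rooted_map_def)
  obtain u where p: "set p \<subseteq> parcs ?M" "pcas u p u" "distinct (map snd p)" "p \<noteq> []"
    using cycle by (auto simp: pre_digraph.cycle_def pre_digraph.awalk_def cas_with_proj_eq
        awalk_verts_with_proj_eq pawalk_verts_eq)
  define m where "m = Max ((\<lambda>i. depth f (snd (p ! i))) ` {..<?n})"
  have "m \<in> (\<lambda>i. depth f (snd (p ! i))) ` {..<?n}"
    unfolding m_def using p(4) by (intro Max_in) auto
  then obtain j where j: "j < ?n" "depth f (snd (p ! j)) = m"
    by auto
  have max: "depth f (snd (p ! i)) \<le> depth f (snd (p ! j))" if "i < ?n" for i
    unfolding j m_def using that by (intro Max_ge) auto
  \<comment> \<open>The heads of the arcs \<open>i\<close> and \<open>k\<close> are the neighbours of the head of arc \<open>j\<close> on the cycle.\<close>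
  define i where "i = (if j = 0 then ?n - 1 else j - 1)"
  define k where "k = (if j = ?n - 1 then 0 else j + 1)"
  have ik: "i < ?n" "k < ?n" "i \<noteq> k"
    using j \<open>\<not> ?n < 3\<close> by (auto simp: i_def k_def)
  have last: "snd (p ! (?n - 1)) = u"
    using pcas_snd_last[OF p(2,4)] p(4) by (simp add: last_conv_nth)
  have fst_j: "fst (p ! j) = snd (p ! i)"
    using pcas_nth_fst[OF p(2) j(1)] last by (auto simp: i_def)
  have fst_k: "fst (p ! k) = snd (p ! j)"
    using pcas_nth_fst[OF p(2) ik(2)] last by (auto simp: k_def)
  have max_parent: "b = f a" if "a \<noteq> b" "b = f a \<or> a = f b" "depth f b \<le> depth f a" for a b
    using that depth_step[OF settles, of b] by (metis Suc_n_not_le_n)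
  have "(snd (p ! i), snd (p ! j)) \<in> parcs ?M" "(snd (p ! j), snd (p ! k)) \<in> parcs ?M"
    using p(1) j ik fst_j fst_k by (metis nth_mem prod.collapse subsetD)+
  then have "snd (p ! i) = f (snd (p ! j))" "snd (p ! k) = f (snd (p ! j))"
    using max_parent max[OF ik(1)] max[OF ik(2)]
    by (auto simp: parcs_mk_symmetric_map_graph)
  moreover have "snd (p ! i) \<noteq> snd (p ! k)"
    using p(3) ik by (simp add: distinct_conv_nth)
  ultimately show False by simp
qed

lemma rooted_forest_map_graph:
  fixes f :: "'v::finite \<Rightarrow> 'v"
  assumes f: "rooted_map f"
  shows "rooted_forest k (map_graph f) \<longleftrightarrow> card {x. f x = x} = k"
proof -
  have "(y, x) \<notin> parcs (map_graph f)" if "(x, y) \<in> parcs (map_graph f)" for x y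
  proof
    assume "(y, x) \<in> parcs (map_graph f)"
    with that have "y = f x" "x = f y" "x \<noteq> y" by auto
    then show False
      using depth_step[of f x] depth_step[of f y] f by (simp add: rooted_map_def)
  qed
  then show ?thesis
    unfolding rooted_forest_def
    using pair_digraph_map_graph[of f] no_cycle_map_graph[OF f]
    by (fastforce simp: weak_components_map_graph[OF f] card_image inj_on_map_component[OF f]
        is_root_map_component[OF f])
qed

text \<open>A directed cycle would be a loop, a pair of opposite arcs or an undirected cycle of length at least
  3, so there is none. Two arcs from \<open>x\<close> would extend the paths from their heads to the root to two
  different paths from \<open>x\<close>: neither path returns to \<open>x\<close>, as this would close a cycle. Hence
  the arcs form a partial function, and acyclicity makes all its orbits settle.\<close>

lemma rooted_forest_is_map_graph:
  fixes F :: "'v::finite pair_pre_digraph"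
  assumes F: "rooted_forest k F" and verts: "pverts F = UNIV"
  obtains f where "rooted_map f" "F = map_graph f"
proof -
  let ?M = "mk_symmetric (with_proj F)"
  have asym: "(u, v) \<in> parcs F \<Longrightarrow> (v, u) \<notin> parcs F" for u v
    using F unfolding rooted_forest_def by blast
  have no_cycle: "\<not> (pre_digraph.cycle (with_proj ?M) p \<and> 3 \<le> length p)" for p
    using F unfolding rooted_forest_def by blast
  interpret F: pair_digraph F
    using F unfolding rooted_forest_def by blast
  interpret M: pair_wf_digraph ?M
    by (rule F.wellformed_mk_symmetric)
  have "subgraph (with_proj F) (with_proj ?M)"
    by (rule subgraphI)
      (auto simp: parcs_mk_symmetric F.wf_digraph_axioms M.wf_digraph_axioms)
  have acyclic: "(x, x) \<notin> (parcs F)\<^sup>+" for x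
  proof
    assume "(x, x) \<in> (parcs F)\<^sup>+"
    then have "\<exists>p. F.closed_w p"
      using F.reachable1_awalk by (auto simp: F.closed_w_def)
    then obtain p where p: "F.cycle p"
      using F.closed_w_imp_cycle by blast
    then have "M.cycle p"
      using M.subgraph_cycle \<open>subgraph F ?M\<close> by blast
    with no_cycle have "length p < 3"
      by (meson not_less)
    moreover obtain u where "F.awalk u p u" "2 \<le> length p"
      using p F.cycle_digraph_conv by blast
    ultimately obtain e e' where "p = [e, e']" "F.awalk u [e, e'] u"
      by (cases p; cases "tl p") auto
    then have "(fst e, snd e) \<in> parcs F" "(snd e, fst e) \<in> parcs F"
      by (cases e; cases e'; auto simp: F.awalk_simps)+
    then show False
      using asym by blast
  qed
  have out_unique: "y = z" if xy: "(x, y) \<in> parcs F" and xz: "(x, z) \<in> parcs F" for x y z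
  proof -
    define S where "S = M.scc_of x"
    define T where "T = \<lparr>pverts = S, parcs = parcs F \<inter> S \<times> S\<rparr>"
    have "S \<in> M.sccs_verts"
      unfolding S_def by (rule M.scc_of_in_sccs_verts) (simp add: verts)
    then have "T \<in> weak_components F"
      by (auto simp: weak_components_def T_def)
    then obtain r where r: "is_root T r"
      using F unfolding rooted_forest_def by blast
    have S: "v \<in> S" if "v = x \<or> (x, v) \<in> parcs F" for v
    proof -
      have "reachable (with_proj ?M) x v"
      proof (cases "v = x")
        case True
        then show ?thesis using verts by (simp add: M.reachable_refl)
      next
        case False
        with that have "(x, v) \<in> parcs ?M"
          by (simp add: parcs_mk_symmetric_iff)
        then show ?thesis by (rule M.reachable_adjI)
      qed
      moreover from this have "reachable (with_proj ?M) v x"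
        by (rule symmetric_reachable[OF symmetric_mk_symmetric])
      ultimately show ?thesis
        by (simp add: S_def M.scc_of_def)
    qed
    interpret T: pair_wf_digraph T
      by unfold_locales (auto simp: T_def)
    have extend: "\<exists>p. T.apath x ((x, v) # p) r" if xv: "(x, v) \<in> parcs F" for v
    proof -
      have "v \<in> pverts T"
        using S xv by (simp add: T_def)
      then obtain p where p: "T.apath v p r"
        using r unfolding is_root_def by blast
      have "x \<notin> set (pawalk_verts v p)"
      proof
        assume "x \<in> set (pawalk_verts v p)"
        then have "reachable (with_proj T) v x"
          using T.awalk_verts_reachable_from[OF T.awalkI_apath[OF p]] by simp
        then have "(v, x) \<in> (parcs T)\<^sup>*"
          using reachable_rtranclI by fastforce
        then have "(v, x) \<in> (parcs F)\<^sup>*"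
          using rtrancl_mono[of "parcs T" "parcs F"] by (auto simp: T_def)
        with xv have "(x, x) \<in> (parcs F)\<^sup>+"
          by (rule rtrancl_into_trancl2)
        then show False using acyclic by blast
      qed
      moreover have "(x, v) \<in> parcs T"
        using xv S by (simp add: T_def)
      ultimately have "T.apath x ((x, v) # p) r"
        using p by (simp add: T.apath_Cons_iff)
      then show ?thesis by blast
    qed
    obtain p q where "T.apath x ((x, y) # p) r" "T.apath x ((x, z) # q) r"
      using extend[OF xy] extend[OF xz] by blast
    moreover have "x \<in> pverts T"
      using S by (simp add: T_def)
    ultimately have "(x, y) # p = (x, z) # q"
      using r unfolding is_root_def by blast
    then show ?thesis by simp
  qed
  define f where "f x = (if \<exists>y. (x, y) \<in> parcs F then THE y. (x, y) \<in> parcs F else x)" for x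
  have arc: "(x, y) \<in> parcs F \<longleftrightarrow> y = f x \<and> f x \<noteq> x" for x y
  proof (cases "\<exists>y. (x, y) \<in> parcs F")
    case True
    then have "\<exists>!y. (x, y) \<in> parcs F"
      using out_unique by blast
    then have x: "(x, f x) \<in> parcs F"
      using theI'[of "\<lambda>y. (x, y) \<in> parcs F"] True by (simp add: f_def)
    then show ?thesis
      using F.no_loops'[OF x] out_unique[OF x, of y] by auto
  qed (auto simp: f_def)
  have "wf ((parcs F)\<inverse>)"
    using acyclic by (intro finite_acyclic_wf_converse) (auto simp: acyclic_def)
  then have "settles f x" for x
  proof (induction x rule: wf_induct_rule)
    case (less x)
    show ?case
    proof (cases "f x = x")
      case True
      then show ?thesis by (rule settles_fixed)
    next
      case False
      then have "(f x, x) \<in> (parcs F)\<inverse>"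
        by (simp add: arc)
      from less[OF this] show ?thesis
        by (simp add: settles_step)
    qed
  qed
  then have "rooted_map f"
    unfolding rooted_map_def by blast
  moreover have "F = map_graph f"
    using arc verts by (intro pair_pre_digraph.equality) auto
  ultimately show ?thesis
    using that by blast
qed

lemma spanning_rooted_forests_eq:
  fixes \<Gamma> :: "'v::finite pair_pre_digraph"
  assumes "weighted_digraph \<Gamma> \<omega>"
  shows "spanning_rooted_forests \<Gamma> k =
    map_graph ` {f. rooted_map f \<and> card {x. f x = x} = k \<and> parcs (map_graph f) \<subseteq> parcs \<Gamma>}"
proof -
  interpret weighted_digraph \<Gamma> \<omega> by fact
  have "spanning (with_proj (map_graph f)) (with_proj \<Gamma>) \<longleftrightarrow> parcs (map_graph f) \<subseteq> parcs \<Gamma>"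
    for f :: "'v \<Rightarrow> 'v"
  proof -
    interpret G: pair_digraph "map_graph f"
      by (rule pair_digraph_map_graph)
    show ?thesis
      using wf_digraph_axioms G.wf_digraph_axioms
      by (auto simp: spanning_def subgraph_def pverts_UNIV)
  qed
  then have "F \<in> spanning_rooted_forests \<Gamma> k \<longleftrightarrow>
      (\<exists>f. F = map_graph f \<and> rooted_map f \<and> card {x. f x = x} = k \<and> parcs (map_graph f) \<subseteq> parcs \<Gamma>)"
    (is "_ \<longleftrightarrow> ?R") for F
  proof -
    assume spanning: "\<And>f :: 'v \<Rightarrow> 'v. spanning (with_proj (map_graph f)) (with_proj \<Gamma>)
      \<longleftrightarrow> parcs (map_graph f) \<subseteq> parcs \<Gamma>"
    show ?thesis
    proof
      assume "F \<in> spanning_rooted_forests \<Gamma> k"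
      then have F: "spanning (with_proj F) (with_proj \<Gamma>)" "rooted_forest k F"
        by (auto simp: spanning_rooted_forests_def)
      then have "pverts F = UNIV"
        by (simp add: spanning_def pverts_UNIV)
      with F(2) obtain f where f: "rooted_map f" "F = map_graph f"
        by (rule rooted_forest_is_map_graph)
      with F show ?R
        using spanning[of f] rooted_forest_map_graph[OF f(1)] by blast
    next
      assume ?R
      then obtain f where f: "F = map_graph f" "rooted_map f" "card {x. f x = x} = k"
        "parcs (map_graph f) \<subseteq> parcs \<Gamma>"
        by blast
      then show "F \<in> spanning_rooted_forests \<Gamma> k"
        using spanning[of f] rooted_forest_map_graph[OF f(2)]
        by (simp add: spanning_rooted_forests_def)
    qed
  qed
  then show ?thesis
    by blast
qed

text \<open>Maps that use pairs outside the digraph have weight zero, so the sums over all rooted maps are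
  sums over the forests of the digraph.\<close>

lemma map_weight_outside:
  assumes "weighted_digraph \<Gamma> \<omega>" "\<not> parcs (map_graph f) \<subseteq> parcs \<Gamma>"
  shows "map_weight \<omega> f = 0"
proof -
  interpret weighted_digraph \<Gamma> \<omega> by fact
  obtain x where "f x \<noteq> x" "(x, f x) \<notin> parcs \<Gamma>"
    using assms(2) by (auto simp: map_graph_def)
  then show ?thesis
    unfolding map_weight_def by (intro prod_zero) (auto simp: weight_zero)
qed

section \<open>Sums over spanning forests of the digraph\<close>

lemma tree_weight_eq:
  fixes \<Gamma> :: "'v::finite pair_pre_digraph"
  assumes W: "weighted_digraph \<Gamma> \<omega>"
  shows "tree_weight \<Gamma> \<omega> w = map_tree_weight \<omega> w"
proof -
  let ?A = "{f \<in> rooted_maps {w}. parcs (map_graph f) \<subseteq> parcs \<Gamma>}"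
  have root: "root_of (map_graph f) = r" if "f \<in> rooted_maps {r}" for f and r :: 'v
  proof -
    have f: "rooted_map f" "f r = r"
      using that by (auto simp: rooted_maps_def)
    have "sink f x = r" for x
      using rooted_maps_sink[OF that] by simp
    then have "map_component f r = map_graph f"
      by (simp add: map_component_def map_graph_def)
    then show ?thesis
      using root_of_map_component[OF f] by simp
  qed
  have "{T \<in> spanning_rooted_forests \<Gamma> 1. root_of T = w} = map_graph ` ?A"
    (is "?L = _")
  proof
    show "?L \<subseteq> map_graph ` ?A"
    proof
      fix T assume "T \<in> ?L"
      then obtain f where f: "T = map_graph f" "rooted_map f" "card {x. f x = x} = 1"
        "parcs (map_graph f) \<subseteq> parcs \<Gamma>" "root_of T = w"
        unfolding spanning_rooted_forests_eq[OF W] by blast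
      then obtain r where "f \<in> rooted_maps {r}"
        by (auto simp: rooted_maps_def card_1_singleton_iff)
      with f root show "T \<in> map_graph ` ?A" by blast
    qed
    show "map_graph ` ?A \<subseteq> ?L"
      unfolding spanning_rooted_forests_eq[OF W] using root
      by (auto simp: rooted_maps_def)
  qed
  then have "tree_weight \<Gamma> \<omega> w = (\<Sum>f\<in>?A. map_weight \<omega> f)"
    by (simp add: tree_weight_def sum.reindex inj_on_subset[OF inj_map_graph] weight_map_graph)
  also have "\<dots> = map_tree_weight \<omega> w"
    unfolding map_tree_weight_def
    using map_weight_outside[OF W] by (intro sum.mono_neutral_left) auto
  finally show ?thesis .
qed

text \<open>Fixing the root \<open>v\<close> of the first component selects at most one of the two namings of the components, so a
  named forest is the same as a second root \<open>w \<noteq> v\<close> and a map with the roots \<open>v\<close> and \<open>w\<close>.\<close>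

lemma sum_split_2_forests:
  fixes \<Gamma> :: "'v::finite pair_pre_digraph"
  assumes W: "weighted_digraph \<Gamma> \<omega>"
  shows "(\<Sum>(F, T1, T2)\<in>{(F, T1, T2) \<in> split_2_forests \<Gamma>. P T1 T2 \<and> root_of T1 = v}.
      c T1 T2 * weight \<omega> F) =
    (\<Sum>w\<in>UNIV - {v}.
      \<Sum>f | f \<in> rooted_maps {v, w} \<and> P (map_component f v) (map_component f w).
        c (map_component f v) (map_component f w) * map_weight \<omega> f)"
proof -
  let ?\<Phi> = "\<lambda>(w, f). (map_graph f, map_component f v, map_component f w)"
  let ?B = "SIGMA w:UNIV - {v}.
    {f. f \<in> rooted_maps {v, w} \<and> P (map_component f v) (map_component f w)}"
  let ?A = "{(w, f) \<in> ?B. parcs (map_graph f) \<subseteq> parcs \<Gamma>}"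
  have img: "{(F, T1, T2) \<in> split_2_forests \<Gamma>. P T1 T2 \<and> root_of T1 = v} = ?\<Phi> ` ?A"
    (is "?L = _")
  proof
    show "?L \<subseteq> ?\<Phi> ` ?A"
    proof clarify
      fix F T1 T2
      assume *: "(F, T1, T2) \<in> split_2_forests \<Gamma>" "P T1 T2" "v = root_of T1"
      then obtain f where f: "F = map_graph f" "rooted_map f" "card {x. f x = x} = 2"
        "parcs (map_graph f) \<subseteq> parcs \<Gamma>" and comps: "weak_components F = {T1, T2}"
        unfolding split_2_forests_def spanning_rooted_forests_eq[OF W] by blast
      have comps: "map_component f ` {x. f x = x} = {T1, T2}"
        using comps weak_components_map_graph[OF f(2)] f(1) by simp
      have "T1 \<in> map_component f ` {x. f x = x}"
        unfolding comps by simp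
      then obtain r where r: "f r = r" "T1 = map_component f r"
        by blast
      then have v: "r = root_of T1"
        using root_of_map_component[OF f(2)] by simp
      have "card ({x. f x = x} - {r}) = 1"
        using f(3) r(1) by simp
      then obtain w where "{x. f x = x} - {r} = {w}"
        by (rule card_1_singletonE)
      then have w: "{x. f x = x} = {r, w}" "w \<noteq> r"
        using r(1) by blast+
      have "map_component f w \<noteq> map_component f r"
        using inj_onD[OF inj_on_map_component[OF f(2)], of w r] w by auto
      then have "T2 = map_component f w"
        using comps r(2) w(1) by (auto simp: doubleton_eq_iff)
      then have "(w, f) \<in> {(w, f) \<in> SIGMA w:UNIV - {root_of T1}.
            {f. f \<in> rooted_maps {root_of T1, w} \<and>
              P (map_component f (root_of T1)) (map_component f w)}.
            parcs (map_graph f) \<subseteq> parcs \<Gamma>}"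
        using f w r *(2) root_of_map_component[OF f(2) r(1)]
        by (simp add: rooted_maps_def flip: v)
      moreover have "(F, T1, T2) = (map_graph f, map_component f (root_of T1), map_component f w)"
        using f(1) r(2) \<open>T2 = _\<close> root_of_map_component[OF f(2) r(1)] by simp
      ultimately show "(F, T1, T2) \<in>
          (\<lambda>(w, f). (map_graph f, map_component f (root_of T1), map_component f w)) `
          {(w, f) \<in> SIGMA w:UNIV - {root_of T1}.
            {f. f \<in> rooted_maps {root_of T1, w} \<and>
              P (map_component f (root_of T1)) (map_component f w)}.
            parcs (map_graph f) \<subseteq> parcs \<Gamma>}"
        by (intro image_eqI[of _ _ "(w, f)"]) simp_all
    qed
    show "?\<Phi> ` ?A \<subseteq> ?L"
    proof clarsimp
      fix w f
      assume *: "w \<noteq> v" "f \<in> rooted_maps {v, w}" "parcs (map_graph f) \<subseteq> parcs \<Gamma>"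
      then have f: "rooted_map f" "{x. f x = x} = {v, w}"
        by (auto simp: rooted_maps_def)
      have "weak_components (map_graph f) = {map_component f v, map_component f w}"
        using weak_components_map_graph[OF f(1)] f(2) by simp
      moreover have "root_of (map_component f v) = v"
        using root_of_map_component[OF f(1)] f(2) by blast
      ultimately show "(map_graph f, map_component f v, map_component f w) \<in> split_2_forests \<Gamma> \<and>
          root_of (map_component f v) = v"
        using * f unfolding split_2_forests_def spanning_rooted_forests_eq[OF W] by auto
    qed
  qed
  have inj: "inj_on ?\<Phi> ?A"
  proof (rule inj_onI, clarsimp)
    fix w f w' f'
    assume *: "w \<noteq> v" "f \<in> rooted_maps {v, w}" "f' \<in> rooted_maps {v, w'}" "w' \<noteq> v"
      "map_graph f = map_graph f'"
    then have "f = f'" using inj_map_graph by (auto dest: injD)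
    with * show "w = w' \<and> f = f'"
      by (auto simp: rooted_maps_def doubleton_eq_iff)
  qed
  have "(\<Sum>(F, T1, T2)\<in>{(F, T1, T2) \<in> split_2_forests \<Gamma>. P T1 T2 \<and> root_of T1 = v}.
      c T1 T2 * weight \<omega> F) =
    (\<Sum>(w, f)\<in>?A. c (map_component f v) (map_component f w) * map_weight \<omega> f)"
    unfolding img sum.reindex[OF inj]
    by (intro sum.cong refl) (auto simp: weight_map_graph)
  also have "\<dots> = (\<Sum>(w, f)\<in>?B. c (map_component f v) (map_component f w) * map_weight \<omega> f)"
  proof (rule sum.mono_neutral_left)
    show "\<forall>p\<in>?B - ?A.
        (case p of (w, f) \<Rightarrow> c (map_component f v) (map_component f w) * map_weight \<omega> f) = 0"
    proof
      fix p assume p: "p \<in> ?B - ?A"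
      obtain w f where wf: "p = (w, f)" by (cases p)
      with p have "\<not> parcs (map_graph f) \<subseteq> parcs \<Gamma>" by blast
      then show "(case p of (w, f) \<Rightarrow> c (map_component f v) (map_component f w) * map_weight \<omega> f) = 0"
        by (simp add: wf map_weight_outside[OF W])
    qed
  qed auto
  finally show ?thesis
    by (simp add: sum.Sigma)
qed

text \<open>Summing \<open>h(z)\<close> over \<open>z\<close> counts every forest with the size \<open>|T\<^sub>1|\<close> of the tree of \<open>v\<close>. A forest
  with \<open>u \<in> T\<^sub>1\<close> thus gets the coefficient \<open>n - |T\<^sub>1| = |T\<^sub>2|\<close>, any other the coefficient
  \<open>- |T\<^sub>1|\<close>.\<close>

lemma component_sizes_hitting:
  fixes \<omega> :: "'v::finite \<times> 'v \<Rightarrow> real"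
  assumes "v \<noteq> w"
  shows "(\<Sum>f | f \<in> rooted_maps {v, w} \<and> sink f u = v. real (card {z. sink f z = w}) * map_weight \<omega> f)
      - (\<Sum>f | f \<in> rooted_maps {v, w} \<and> sink f u = w. real (card {z. sink f z = v}) * map_weight \<omega> f)
    = real CARD('v) * hitting \<omega> v w u - (\<Sum>z\<in>UNIV. hitting \<omega> v w z)"
proof -
  let ?S = "rooted_maps {v, w}" and ?n = "real CARD('v)"
  have pick: "(\<Sum>f | f \<in> ?S \<and> P f. g f) = (\<Sum>f\<in>?S. if P f then g f else 0)"
    for P and g :: "('v \<Rightarrow> 'v) \<Rightarrow> real"
    by (simp add: sum.inter_filter)
  have size: "real (card {z. sink f z = v}) = (\<Sum>z\<in>UNIV. if sink f z = v then 1 else 0)" for f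
    by (simp add: sum.If_cases)
  have total: "real (card {z. sink f z = w}) = ?n - real (card {z. sink f z = v})" if "f \<in> ?S" for f
  proof -
    have "{z. sink f z = w} = - {z. sink f z = v}"
      using rooted_maps_sink[OF that] assms by auto
    then show ?thesis
      by (simp add: Compl_eq_Diff_UNIV card_Diff_subset of_nat_diff card_mono)
  qed
  have "(\<Sum>z\<in>UNIV. hitting \<omega> v w z) = (\<Sum>f\<in>?S. real (card {z. sink f z = v}) * map_weight \<omega> f)"
    unfolding hitting_def pick size sum_distrib_right
    by (subst sum.swap) (intro sum.cong refl, simp)
  moreover have "?n * hitting \<omega> v w u = (\<Sum>f\<in>?S. if sink f u = v then ?n * map_weight \<omega> f else 0)"
    unfolding hitting_def pick sum_distrib_left by (intro sum.cong refl) simp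
  ultimately show ?thesis
    unfolding pick sum_subtractf[symmetric]
  proof (simp only: sum_subtractf[symmetric], intro sum.cong refl)
    fix f assume f: "f \<in> ?S"
    show "(if sink f u = v then real (card {z. sink f z = w}) * map_weight \<omega> f else 0)
        - (if sink f u = w then real (card {z. sink f z = v}) * map_weight \<omega> f else 0)
      = (if sink f u = v then ?n * map_weight \<omega> f else 0) - real (card {z. sink f z = v}) * map_weight \<omega> f"
      using rooted_maps_sink[OF f, of u] assms total[OF f] by (auto simp: left_diff_distrib)
  qed
qed

theorem theorem1p1:
  fixes \<Gamma> :: "'v::finite pair_pre_digraph"
    and \<omega> :: "'v \<times> 'v \<Rightarrow> real"
    and n :: nat
    and u v :: 'v
  assumes "weighted_digraph \<Gamma> \<omega>"
    and "strongly_connected (with_proj \<Gamma>)"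
    and "n = card (pverts \<Gamma>)"
  shows "green \<omega> $ u $ v =
    1 / (real n * (\<Sum>w\<in>pverts \<Gamma>. (tree_weight \<Gamma> \<omega> w)\<^sup>2)) *
    ((\<Sum>(F, T1, T2)\<in>{(F, T1, T2) \<in> split_2_forests \<Gamma>. u \<in> pverts T1 \<and> root_of T1 = v}.
        real (card (pverts T2)) * tree_weight \<Gamma> \<omega> (root_of T2) * weight \<omega> F)
     - (\<Sum>(F, T1, T2)\<in>{(F, T1, T2) \<in> split_2_forests \<Gamma>. u \<in> pverts T2 \<and> root_of T1 = v}.
        real (card (pverts T1)) * tree_weight \<Gamma> \<omega> (root_of T2) * weight \<omega> F))"
proof -
  interpret weighted_digraph \<Gamma> \<omega> by fact
  let ?\<tau> = "map_tree_weight \<omega>"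
  have nonneg: "\<omega> e \<ge> 0" for e
    using weight_pos[of e] weight_zero[of e] by (cases "e \<in> parcs \<Gamma>") auto
  have "{e. \<omega> e > 0} = parcs \<Gamma>"
    using weight_pos weight_zero by fastforce
  moreover have "(x, y) \<in> (parcs \<Gamma>)\<^sup>*" for x y
    using assms(2) reachable_rtranclI[of "with_proj \<Gamma>" x y]
    by (simp add: strongly_connected_def pverts_UNIV)
  ultimately have conn: "(x, y) \<in> {e. \<omega> e > 0}\<^sup>*" for x y
    by simp
  have n: "n = CARD('v)" "n > 0"
    using assms(3) by (simp_all add: pverts_UNIV)
  have root: "root_of (map_component f w) = w" if "f \<in> rooted_maps {v, w}" for f w
    using that root_of_map_component[of f w] by (auto simp: rooted_maps_def)
  have same_part: "(\<Sum>(F, T1, T2)\<in>{(F, T1, T2) \<in> split_2_forests \<Gamma>. u \<in> pverts T1 \<and> root_of T1 = v}.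
        real (card (pverts T2)) * tree_weight \<Gamma> \<omega> (root_of T2) * weight \<omega> F) =
      (\<Sum>w\<in>UNIV - {v}. ?\<tau> w *
        (\<Sum>f | f \<in> rooted_maps {v, w} \<and> sink f u = v. real (card {z. sink f z = w}) * map_weight \<omega> f))"
    unfolding sum_split_2_forests[OF assms(1), where P = "\<lambda>T1 T2. u \<in> pverts T1" and v = v
        and c = "\<lambda>T1 T2. real (card (pverts T2)) * tree_weight \<Gamma> \<omega> (root_of T2)"] sum_distrib_left
    by (intro sum.cong) (auto simp: root tree_weight_eq[OF assms(1)])
  have other_part: "(\<Sum>(F, T1, T2)\<in>{(F, T1, T2) \<in> split_2_forests \<Gamma>. u \<in> pverts T2 \<and> root_of T1 = v}.
        real (card (pverts T1)) * tree_weight \<Gamma> \<omega> (root_of T2) * weight \<omega> F) =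
      (\<Sum>w\<in>UNIV - {v}. ?\<tau> w *
        (\<Sum>f | f \<in> rooted_maps {v, w} \<and> sink f u = w. real (card {z. sink f z = v}) * map_weight \<omega> f))"
    unfolding sum_split_2_forests[OF assms(1), where P = "\<lambda>T1 T2. u \<in> pverts T2" and v = v
        and c = "\<lambda>T1 T2. real (card (pverts T1)) * tree_weight \<Gamma> \<omega> (root_of T2)"] sum_distrib_left
    by (intro sum.cong) (auto simp: root tree_weight_eq[OF assms(1)])
  have "green \<omega> $ u $ v = hitting_green \<omega> u v"
    using nonneg conn by (rule green_hitting)
  also have "\<dots> = (\<Sum>w\<in>UNIV - {v}. ?\<tau> w *
        (real n * hitting \<omega> v w u - (\<Sum>z\<in>UNIV. hitting \<omega> v w z)) / real n)
      / (\<Sum>w\<in>UNIV. (?\<tau> w)\<^sup>2)"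
    unfolding hitting_green_def n(1)[symmetric] using n(2)
    by (intro arg_cong2[of _ _ _ _ "(/)"] sum.cong refl) (simp add: field_simps)
  also have "\<dots> = 1 / (real n * (\<Sum>w\<in>UNIV. (?\<tau> w)\<^sup>2)) * (\<Sum>w\<in>UNIV - {v}. ?\<tau> w *
        (real n * hitting \<omega> v w u - (\<Sum>z\<in>UNIV. hitting \<omega> v w z)))"
    by (simp add: sum_divide_distrib[symmetric])
  also have "(\<Sum>w\<in>UNIV - {v}. ?\<tau> w *
        (real n * hitting \<omega> v w u - (\<Sum>z\<in>UNIV. hitting \<omega> v w z))) =
      (\<Sum>w\<in>UNIV - {v}. ?\<tau> w *
        (\<Sum>f | f \<in> rooted_maps {v, w} \<and> sink f u = v. real (card {z. sink f z = w}) * map_weight \<omega> f))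
      - (\<Sum>w\<in>UNIV - {v}. ?\<tau> w *
        (\<Sum>f | f \<in> rooted_maps {v, w} \<and> sink f u = w. real (card {z. sink f z = v}) * map_weight \<omega> f))"
    unfolding sum_subtractf[symmetric] right_diff_distrib[symmetric] n(1)
    by (intro sum.cong refl) (use component_sizes_hitting[where v = v and u = u and \<omega> = \<omega>] in auto)
  finally show ?thesis
    unfolding same_part other_part
    unfolding pverts_UNIV tree_weight_eq[OF assms(1)] .
qed

end
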